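(* Let $F=x^{-1}+1+x+y^{-1}+y\in\mathrm{GF}(2)[x,x^{-1},y,y^{-1}]$ (the von Neumann neighborhood in $\mathbb{Z}^2$ together with its center). For $n\ge0$ let $b_n=|F^{2^n-1}|$, the number of ON cells at generation $2^n-1$ of the odd-rule cellular automaton with neighborhood $F$ started from a single ON cell at the origin. Then $b_0=1$, $b_1=5$, and $b_{n+1}=3b_n+2b_{n-1}$ for all $n\ge1$.
   Context: For a Laurent polynomial $P$ with coefficients in $\mathrm{GF}(2)$, $|P|$ denotes the number of its nonzero terms. In the odd-rule CA with neighborhood $F$, a cell $u\in\mathbb{Z}^2$ is identified with the monomial $x^{u_1}y^{u_2}$, the neighborhood of cell $w$ is $x^{w_1}y^{w_2}F$, and a cell is ON at generation $n+1$ iff it lies in the neighborhoods of an odd number of cells that are ON at generation $n$; the state at generation $m$ is $F^m$. *)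

theory Defs
  imports "HOL-Library.Poly_Mapping" "HOL-Library.Product_Plus" "HOL-Library.Z2"
begin

text \<open>
  The Laurent polynomial ring \<open>GF(2)[x, x\<inverse>, y, y\<inverse>]\<close> is the group ring of the additive group
  \<open>\<int> \<times> \<int>\<close> over the two-element field \<^typ>\<open>bit\<close>: finitely supported coefficient functions under
  convolution, where the exponent pair \<open>(i, j)\<close> stands for \<open>x^i y^j\<close>.
\<close>

type_synonym cell = "int \<times> int"
type_synonym laurent2 = "cell \<Rightarrow>\<^sub>0 bit"

definition mon :: "cell \<Rightarrow> laurent2" where
  "mon w = Poly_Mapping.single w 1"

definition num_terms :: "laurent2 \<Rightarrow> nat" where
  "num_terms P = card (Poly_Mapping.keys P)"

definition neighborhood :: "laurent2 \<Rightarrow> cell \<Rightarrow> cell set" where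
  "neighborhood F w = Poly_Mapping.keys (mon w * F)"

definition odd_rule_step :: "laurent2 \<Rightarrow> cell set \<Rightarrow> cell set" where
  "odd_rule_step F S = {u. odd (card {w \<in> S. u \<in> neighborhood F w})}"

definition on_cells :: "laurent2 \<Rightarrow> nat \<Rightarrow> cell set" where
  "on_cells F m = (odd_rule_step F ^^ m) {(0, 0)}"

definition centered_von_Neumann :: laurent2 where
  "centered_von_Neumann = mon (-1, 0) + 1 + mon (1, 0) + mon (0, -1) + mon (0, 1)"

lemma bit_sum_eq_odd_card:
  fixes f :: "'a \<Rightarrow> bit"
  assumes "finite A"
  shows "sum f A \<noteq> 0 \<longleftrightarrow> odd (card {a \<in> A. f a \<noteq> 0})"
  using assms
proof (induction A rule: finite_induct)
  case (insert a A)
  have "{b \<in> insert a A. f b \<noteq> 0} =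
      (if f a \<noteq> 0 then insert a {b \<in> A. f b \<noteq> 0} else {b \<in> A. f b \<noteq> 0})"
    by auto
  with insert show ?case
    by (cases "f a"; cases "sum f A") auto
qed simp

lemma laurent2_eq_sum_mon: "P = (\<Sum>w\<in>Poly_Mapping.keys P. mon w)"
proof (rule poly_mapping_eqI)
  fix u
  have "Poly_Mapping.lookup (\<Sum>w\<in>Poly_Mapping.keys P. mon w) u
      = (\<Sum>w\<in>Poly_Mapping.keys P. if w = u then 1 else 0)"
    by (simp add: lookup_sum mon_def lookup_single when_def)
  also have "\<dots> = Poly_Mapping.lookup P u"
    by (simp add: in_keys_iff)
  finally show "Poly_Mapping.lookup P u = Poly_Mapping.lookup (\<Sum>w\<in>Poly_Mapping.keys P. mon w) u" ..
qed

lemma keys_times_eq_odd_rule_step: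
  "Poly_Mapping.keys (F * P) = odd_rule_step F (Poly_Mapping.keys P)"
proof -
  have "F * P = (\<Sum>w\<in>Poly_Mapping.keys P. mon w * F)"
    by (subst laurent2_eq_sum_mon[of P]) (simp add: sum_distrib_left mult.commute)
  then have "Poly_Mapping.lookup (F * P) u = (\<Sum>w\<in>Poly_Mapping.keys P. Poly_Mapping.lookup (mon w * F) u)" for u
    by (simp add: lookup_sum)
  then show ?thesis
    unfolding odd_rule_step_def neighborhood_def in_keys_iff set_eq_iff mem_Collect_eq
    by (simp only: bit_sum_eq_odd_card finite_keys in_keys_iff simp_thms)
qed

lemma on_cells_eq_keys_power: "on_cells F m = Poly_Mapping.keys (F ^ m)"
proof (induction m)
  case 0
  have "Poly_Mapping.keys (1 :: laurent2) = {(0, 0)}"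
    by (simp flip: single_one zero_prod_def)
  then show ?case
    by (simp add: on_cells_def)
next
  case (Suc m)
  then show ?case
    by (simp add: on_cells_def keys_times_eq_odd_rule_step)
qed

end

theory Submission
  imports Defs
begin

text \<open>
  Put \<open>G = F ^ (2^n - 1)\<close>, so that \<open>F ^ (2^(n+1) - 1) = F G\<^sup>2\<close>. Over \<open>GF(2)\<close> a square has the same
  number of terms as its root and only even exponents, so the terms of a polynomial multiple of
  \<open>G\<^sup>2\<close> can be counted separately in each parity class of exponents. With \<open>c = |(1 + x) G|\<close> and
  \<open>d = |(1 + y) G|\<close>, the decompositions of \<open>F G\<^sup>2\<close>, \<open>(1 + x) F G\<^sup>2\<close> and \<open>(1 + y) F G\<^sup>2\<close> yield
  \<open>b' = b + c + d\<close>, \<open>c' = 2 b + 2 d\<close> and \<open>d' = 2 b + 2 c\<close>, and eliminating \<open>c + d\<close> gives the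
  recurrence.
\<close>

lemma mon_mult: "mon u * mon v = mon (u + v)"
  by (simp add: mon_def mult_single)

lemma mon_zero: "mon (0, 0) = 1"
  by (simp add: mon_def flip: single_one zero_prod_def)

lemma laurent2_double [simp]: "P + P = (0 :: laurent2)"
proof (rule poly_mapping_eqI)
  fix u
  have "p + p = 0" for p :: bit
    by (cases p) simp_all
  then show "Poly_Mapping.lookup (P + P) u = Poly_Mapping.lookup 0 u"
    by (simp only: lookup_add lookup_zero)
qed

text \<open>With \<open>laurent2_double\<close>, this cancels equal summands once AC rewriting has
  made them adjacent.\<close>

lemma laurent2_double_left [simp]: "P + (P + Q) = (Q :: laurent2)"
  by (simp flip: add.assoc)

text \<open>Injectivity keeps the monomials distinct, so nothing cancels modulo 2.\<close>

lemma keys_sum_mon: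
  assumes "finite A" "inj_on f A"
  shows "Poly_Mapping.keys (\<Sum>w\<in>A. mon (f w)) = f ` A"
proof -
  have "Poly_Mapping.lookup (\<Sum>w\<in>A. mon (f w)) u \<noteq> 0 \<longleftrightarrow> u \<in> f ` A" for u
  proof -
    have "(\<Sum>w\<in>A. mon (f w)) = (\<Sum>v\<in>f ` A. mon v)"
      using assms(2) by (simp add: sum.reindex)
    then show ?thesis
      using assms(1) by (simp add: lookup_sum mon_def lookup_single when_def)
  qed
  then show ?thesis
    by (simp only: in_keys_iff set_eq_iff simp_thms)
qed

text \<open>Frobenius in characteristic 2: each cross term occurs twice and vanishes.\<close>

lemma laurent2_square_sum:
  "finite A \<Longrightarrow> (\<Sum>w\<in>A. f w :: laurent2)\<^sup>2 = (\<Sum>w\<in>A. (f w)\<^sup>2)"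
proof (induction A rule: finite_induct)
  case (insert a A)
  then show ?case
    by (simp add: power2_eq_square algebra_simps)
qed simp

lemma keys_mon_mult_square:
  "Poly_Mapping.keys (mon a * P\<^sup>2) = (\<lambda>w. a + (w + w)) ` Poly_Mapping.keys P"
proof -
  have "mon a * P\<^sup>2 = mon a * (\<Sum>w\<in>Poly_Mapping.keys P. mon w)\<^sup>2"
    by (simp flip: laurent2_eq_sum_mon)
  also have "\<dots> = (\<Sum>w\<in>Poly_Mapping.keys P. mon (a + (w + w)))"
    by (simp only: laurent2_square_sum finite_keys sum_distrib_left)
      (simp only: power2_eq_square mon_mult)
  finally show ?thesis
    by (simp add: keys_sum_mon inj_on_def prod_eq_iff)
qed

lemma num_terms_mon_mult_square: "num_terms (mon a * P\<^sup>2) = num_terms P"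
  unfolding num_terms_def keys_mon_mult_square
  by (rule card_image) (simp add: inj_on_def prod_eq_iff)

lemma num_terms_mon_mult: "num_terms (mon a * P) = num_terms P"
proof -
  \<comment> \<open>Squaring preserves the count and turns the shift by \<open>a\<close> into a
    shift by \<open>a + a\<close>, so the count for shifted squares applies at both ends.\<close>
  have "num_terms (mon a * P) = num_terms (mon (0, 0) * (mon a * P)\<^sup>2)"
    by (simp only: num_terms_mon_mult_square)
  also have "\<dots> = num_terms (mon (a + a) * P\<^sup>2)"
    by (simp add: mon_zero power2_eq_square mult_ac flip: mon_mult)
  also have "\<dots> = num_terms P"
    by (rule num_terms_mon_mult_square)
  finally show ?thesis .
qed

lemma num_terms_add:
  assumes "Poly_Mapping.keys P \<inter> Poly_Mapping.keys Q = {}"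
  shows "num_terms (P + Q) = num_terms P + num_terms Q"
proof -
  have "Poly_Mapping.keys (P + Q) = Poly_Mapping.keys P \<union> Poly_Mapping.keys Q"
  proof (rule set_eqI)
    fix u
    have "u \<notin> Poly_Mapping.keys P \<or> u \<notin> Poly_Mapping.keys Q"
      using assms by blast
    then show "u \<in> Poly_Mapping.keys (P + Q) \<longleftrightarrow> u \<in> Poly_Mapping.keys P \<union> Poly_Mapping.keys Q"
      by (elim disjE) (simp_all add: in_keys_iff lookup_add)
  qed
  with assms show ?thesis
    by (simp add: num_terms_def card_Un_disjoint)
qed

text \<open>The four shifts represent the four parity classes of exponent pairs, so the summands
  have disjoint supports. Negative representatives match the terms x^-1 and y^-1 of the
  neighborhood.\<close>

lemma num_terms_parity_decomposition:
  "num_terms (P\<^sup>2 + mon (-1, 0) * Q\<^sup>2 + mon (0, -1) * R\<^sup>2 + mon (-1, -1) * S\<^sup>2)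
    = num_terms P + num_terms Q + num_terms R + num_terms S"
proof -
  define A where "A = mon (0, 0) * P\<^sup>2"
  define B where "B = mon (-1, 0) * Q\<^sup>2"
  define C where "C = mon (0, -1) * R\<^sup>2"
  define D where "D = mon (-1, -1) * S\<^sup>2"
  define cls :: "bool \<Rightarrow> bool \<Rightarrow> cell set"
    where "cls p q = {u. even (fst u) = p \<and> even (snd u) = q}" for p q
  have keys: "Poly_Mapping.keys A \<subseteq> cls True True" "Poly_Mapping.keys B \<subseteq> cls False True"
    "Poly_Mapping.keys C \<subseteq> cls True False" "Poly_Mapping.keys D \<subseteq> cls False False"
    by (auto simp: A_def B_def C_def D_def cls_def keys_mon_mult_square)
  have 1: "num_terms (A + B) = num_terms A + num_terms B"
    by (rule num_terms_add) (use keys in \<open>auto simp: cls_def\<close>)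
  have AB: "Poly_Mapping.keys (A + B) \<subseteq> cls True True \<union> cls False True"
    using Poly_Mapping.keys_add[of A B] keys by blast
  have 2: "num_terms (A + B + C) = num_terms (A + B) + num_terms C"
    by (rule num_terms_add) (use keys AB in \<open>auto simp: cls_def\<close>)
  have ABC: "Poly_Mapping.keys (A + B + C) \<subseteq> cls True True \<union> cls False True \<union> cls True False"
    using Poly_Mapping.keys_add[of "A + B" C] AB keys by blast
  have 3: "num_terms (A + B + C + D) = num_terms (A + B + C) + num_terms D"
    by (rule num_terms_add) (use keys ABC in \<open>auto simp: cls_def\<close>)
  have "num_terms (A + B + C + D) = num_terms P + num_terms Q + num_terms R + num_terms S"
    unfolding 3 2 1 by (simp add: A_def B_def C_def D_def num_terms_mon_mult_square)
  then show ?thesis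
    by (simp add: A_def B_def C_def D_def mon_zero)
qed

lemma num_terms_von_Neumann_mult_square:
  "num_terms (centered_von_Neumann * G\<^sup>2)
    = num_terms G + num_terms ((1 + mon (1, 0)) * G) + num_terms ((1 + mon (0, 1)) * G)"
proof -
  \<comment> \<open>Here F = 1 + x^-1 (1 + x)^2 + y^-1 (1 + y)^2; the odd-odd class is
    empty.\<close>
  have "centered_von_Neumann * G\<^sup>2 = G\<^sup>2 + mon (-1, 0) * ((1 + mon (1, 0)) * G)\<^sup>2
      + mon (0, -1) * ((1 + mon (0, 1)) * G)\<^sup>2 + mon (-1, -1) * 0\<^sup>2"
    by (simp add: centered_von_Neumann_def power2_eq_square algebra_simps mon_mult mon_zero
        flip: mult.assoc)
  then show ?thesis
    by (simp only: num_terms_parity_decomposition) (simp add: num_terms_def)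
qed

lemma num_terms_x_von_Neumann_mult_square:
  "num_terms ((1 + mon (1, 0)) * (centered_von_Neumann * G\<^sup>2))
    = 2 * num_terms G + 2 * num_terms ((1 + mon (0, 1)) * G)"
proof -
  \<comment> \<open>Here (1 + x) F = x^2 + x^-1 + (y^-1 + x y^-1) (1 + y)^2, and x y^-1 is x^-1 y^-1
    times the square x^2.\<close>
  have "(1 + mon (1, 0)) * (centered_von_Neumann * G\<^sup>2)
      = (mon (1, 0) * G)\<^sup>2 + mon (-1, 0) * G\<^sup>2 + mon (0, -1) * ((1 + mon (0, 1)) * G)\<^sup>2
        + mon (-1, -1) * (mon (1, 0) * ((1 + mon (0, 1)) * G))\<^sup>2"
    by (simp add: centered_von_Neumann_def power2_eq_square algebra_simps mon_mult mon_zero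
        flip: mult.assoc)
  then show ?thesis
    by (simp only: num_terms_parity_decomposition num_terms_mon_mult)
qed

lemma num_terms_y_von_Neumann_mult_square:
  "num_terms ((1 + mon (0, 1)) * (centered_von_Neumann * G\<^sup>2))
    = 2 * num_terms G + 2 * num_terms ((1 + mon (1, 0)) * G)"
proof -
  \<comment> \<open>The same expansion with x and y exchanged.\<close>
  have "(1 + mon (0, 1)) * (centered_von_Neumann * G\<^sup>2)
      = (mon (0, 1) * G)\<^sup>2 + mon (-1, 0) * ((1 + mon (1, 0)) * G)\<^sup>2 + mon (0, -1) * G\<^sup>2
        + mon (-1, -1) * (mon (0, 1) * ((1 + mon (1, 0)) * G))\<^sup>2"
    by (simp add: centered_von_Neumann_def power2_eq_square algebra_simps mon_mult mon_zero
        flip: mult.assoc)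
  then show ?thesis
    by (simp only: num_terms_parity_decomposition num_terms_mon_mult)
qed

theorem theorem5:
  fixes F :: laurent2 and b :: "nat \<Rightarrow> nat"
  assumes F_def: "F = centered_von_Neumann"
    and b_def: "\<And>n. b n = num_terms (F ^ (2 ^ n - 1))"
  shows "(\<forall>n. b n = card (on_cells F (2 ^ n - 1)))
    \<and> b 0 = 1 \<and> b 1 = 5 \<and> (\<forall>n\<ge>1. b (n + 1) = 3 * b n + 2 * b (n - 1))"
proof -
  define G where "G n = F ^ (2 ^ n - 1)" for n :: nat
  define c where "c n = num_terms ((1 + mon (1, 0)) * G n)" for n
  define d where "d n = num_terms ((1 + mon (0, 1)) * G n)" for n
  have G_Suc: "G (Suc n) = centered_von_Neumann * (G n)\<^sup>2" for n
  proof -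
    have "2 ^ Suc n - 1 = Suc ((2 ^ n - 1) * 2)" for n :: nat
      \<comment> \<open>The bound \<open>1 \<le> 2 ^ n\<close> keeps the natural-number subtraction
        from truncating.\<close>
      using one_le_power[of "2 :: nat" n] unfolding power_Suc by linarith
    then show ?thesis
      by (simp only: G_def power_Suc power_mult F_def)
  qed
  have b_G: "b n = num_terms (G n)" for n
    by (simp add: b_def G_def)
  have b_Suc: "b (Suc n) = b n + c n + d n" for n
    by (simp add: b_G G_Suc c_def d_def num_terms_von_Neumann_mult_square)
  have c_Suc: "c (Suc n) = 2 * b n + 2 * d n" for n
    by (simp add: b_G G_Suc c_def d_def num_terms_x_von_Neumann_mult_square)
  have d_Suc: "d (Suc n) = 2 * b n + 2 * c n" for n
    by (simp add: b_G G_Suc c_def d_def num_terms_y_von_Neumann_mult_square)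
  have b_0: "b 0 = 1"
    by (simp add: b_def num_terms_def)
  have two: "num_terms (1 + mon u) = 2" if "u \<noteq> (0, 0)" for u
  proof -
    have one: "num_terms (mon v) = 1" for v
      by (simp add: num_terms_def mon_def)
    have "num_terms (mon (0, 0) + mon u) = num_terms (mon (0, 0)) + num_terms (mon u)"
      by (rule num_terms_add) (use that in \<open>auto simp: mon_def\<close>)
    then show ?thesis
      unfolding one by (simp add: mon_zero)
  qed
  \<comment> \<open>Since \<open>G 0 = 1\<close>, both \<open>c 0\<close> and \<open>d 0\<close>
    count a binomial: 1 + 2 + 2.\<close>
  have "b 1 = 5"
    using b_Suc[of 0] b_0 by (simp add: c_def d_def G_def two)
  moreover have "b (n + 1) = 3 * b n + 2 * b (n - 1)" if "n \<ge> 1" for n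
  proof -
    obtain m where "n = Suc m"
      using \<open>n \<ge> 1\<close> by (cases n) auto
    \<comment> \<open>Both sides unfold to \<open>5 * b m + 3 * c m + 3 * d m\<close>.\<close>
    then show ?thesis
      by (simp add: b_Suc c_Suc d_Suc)
  qed
  ultimately show ?thesis
    using b_0 by (simp add: b_def num_terms_def on_cells_eq_keys_power)
qed

end
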